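(* For every $n\ge 1$ and every $r\ge 3$ we have $tt^{(r)}(n)\le 15r$.
   Context: A permutation is any finite sequence of distinct integers; a permutation of $[n]=\{1,\dots,n\}$ is one whose set of entries is $[n]$. Two permutations $(x_1,\dots,x_k)$ and $(y_1,\dots,y_k)$ of the same length are similar if $x_i<x_j$ if and only if $y_i<y_j$ for all $1\le i<j\le k$. For an integer $r\ge 2$, a collection of $r$ pairwise disjoint (occupying pairwise disjoint sets of positions), pairwise similar subsequences of a permutation $\pi$, each of length $k\ge 1$, forms tight $r$-twins of length $k$ in $\pi$ if the union of the positions they occupy is a segment of consecutive positions of $\pi$ (of length $rk$). Let $tt^{(r)}(\pi)$ be the maximum $k$ such that $\pi$ contains tight $r$-twins of length $k$ (taken to be $0$ if there are none, i.e. if $\pi$ has length less than $r$), and let $tt^{(r)}(n)=\min\{tt^{(r)}(\pi):\pi\text{ is a permutation of }[n]\}$. *)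

theory Defs
  imports Main "HOL-Library.Disjoint_Sets"
begin

definition permutation_of :: "nat \<Rightarrow> int list \<Rightarrow> bool" where
  "permutation_of n xs \<longleftrightarrow> distinct xs \<and> set xs = {1..int n}"

definition similar :: "int list \<Rightarrow> int list \<Rightarrow> bool" where
  "similar xs ys \<longleftrightarrow> length xs = length ys \<and>
     (\<forall>i j. i < j \<and> j < length xs \<longrightarrow> (xs ! i < xs ! j \<longleftrightarrow> ys ! i < ys ! j))"

text \<open>
  A subsequence of \<open>xs\<close> is given by the set \<open>P\<close> of (0-based) positions it occupies; its
  entries, in order, are \<open>nths xs P\<close>. Since the members of \<open>F\<close> are disjoint and nonempty,
  a set of \<open>r\<close> position sets is the same as a collection of \<open>r\<close> disjoint subsequences.
\<close>
definition tight_twins :: "nat \<Rightarrow> nat \<Rightarrow> int list \<Rightarrow> nat set set \<Rightarrow> bool" where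
  "tight_twins r k xs F \<longleftrightarrow>
     k \<ge> 1 \<and> finite F \<and> card F = r \<and> disjoint F \<and>
     (\<forall>P\<in>F. P \<subseteq> {..<length xs} \<and> card P = k) \<and>
     (\<forall>P\<in>F. \<forall>Q\<in>F. similar (nths xs P) (nths xs Q)) \<and>
     (\<exists>s. s + r * k \<le> length xs \<and> \<Union>F = {s..<s + r * k})"

definition tt_perm :: "nat \<Rightarrow> int list \<Rightarrow> nat" where
  "tt_perm r xs = Max (insert 0 {k. \<exists>F. tight_twins r k xs F})"

definition tt :: "nat \<Rightarrow> nat \<Rightarrow> nat" where
  "tt r n = Min {tt_perm r xs | xs. permutation_of n xs}"

text \<open>The maximum and the minimum above range over finite (and the latter nonempty) sets.\<close>

lemma finite_twin_lengths:
  assumes "r \<ge> 1"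
  shows "finite {k. \<exists>F. tight_twins r k xs F}"
proof (rule finite_subset)
  show "{k. \<exists>F. tight_twins r k xs F} \<subseteq> {..length xs}"
  proof clarsimp
    fix k F assume "tight_twins r k xs F"
    then have "r * k \<le> length xs" unfolding tight_twins_def by auto
    moreover have "k \<le> r * k" using assms by simp
    ultimately show "k \<le> length xs" by linarith
  qed
qed simp

lemma finite_permutation_of: "finite {xs. permutation_of n xs}"
proof (rule finite_subset)
  show "{xs. permutation_of n xs} \<subseteq> {xs. set xs \<subseteq> {1..int n} \<and> length xs = n}"
    unfolding permutation_of_def by (auto dest: distinct_card)
  show "finite {xs. set xs \<subseteq> {1..int n} \<and> length xs = n}"
    by (rule finite_lists_length_eq) simp
qed

lemma permutation_of_upto: "permutation_of n [1..int n]"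
  by (simp add: permutation_of_def)

end

theory Submission
  imports Defs "HOL-Combinatorics.Multiset_Permutations" Complex_Main
begin

text \<open>
  Some arrangement of \<open>{1..n}\<close> has no block (factor of consecutive entries) that splits into
  \<open>r\<close> twins of a length \<open>k > 15 * r\<close>. The reason is that such blocks are very rare: a
  permutation of \<open>r * k\<close> given values that splits into \<open>r\<close> pairwise similar classes is determined
  by the colouring of the positions by classes, the colouring of the values by classes, and the
  common pattern of the classes. Hence there are at most \<open>r ^ (r * k) * r ^ (r * k) * k ^ k\<close> of
  them (\<open>card_twin_words_le\<close>), and comparison with \<open>(r * k)!\<close>, using \<open>n! \<ge> (n / 3) ^ n\<close>, shows
  that they make up a proportion of at most \<open>(2 / 5) ^ k\<close> of all permutations of these values
  (\<open>twin_word_ratio\<close>).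

  To avoid all blocks simultaneously, a counting argument in the style of Rosenfeld takes the place
  of the Lovasz Local Lemma. Let \<open>g A\<close> be the number of arrangements of \<open>A\<close> without a bad block.
  The claim, proved by induction on the size of \<open>A\<close>, is that at least a proportion \<open>\<beta>\<close> of the
  arrangements that are good up to their last entry are good altogether
  (\<open>avoiders_ratio\<close>). An arrangement that is good up to its last entry but not
  altogether ends in a bad block, of some length \<open>m\<close>, preceded by a good prefix. For a fixed prefix at most a proportion \<open>p m\<close> of the
  continuations are bad blocks, and by the induction hypothesis the arrangements with a good prefix
  missing \<open>m\<close> entries are at most \<open>1 / \<beta> ^ (m - 1)\<close> times as many as those with a good prefix
  missing one entry. So the claim holds as soon as \<open>\<Sum>m. p m / \<beta> ^ (m - 1) \<le> 1 - \<beta>\<close>. For twins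
  \<open>\<beta> = 1 - 1 / (2 * r)\<close> works: then \<open>\<beta> ^ r \<ge> 1 / 2\<close>, so the sum is at most
  \<open>\<Sum>k>15 * r. (4 / 5) ^ k\<close>, which is far below \<open>1 / (2 * r)\<close>.
\<close>

section \<open>Counting arrangements that avoid a family of factors\<close>

text \<open>
  The empty block is exempt, so that the empty list avoids every \<open>T\<close> and the counting below
  starts from a positive number.
\<close>
definition avoids :: "('a list \<Rightarrow> bool) \<Rightarrow> 'a list \<Rightarrow> bool" where
  "avoids T xs \<longleftrightarrow> (\<forall>a b c. xs = a @ b @ c \<longrightarrow> T b \<longrightarrow> b = [])"

text \<open>
  The condition concerns only the prefix that lacks the last \<open>m\<close> entries. These sets interpolate
  between the avoiding arrangements (\<open>m = 0\<close>) and all arrangements (\<open>m = card A\<close>).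
\<close>
definition prefix_avoiders :: "('a list \<Rightarrow> bool) \<Rightarrow> nat \<Rightarrow> 'a set \<Rightarrow> 'a list set" where
  "prefix_avoiders T m A = {xs \<in> permutations_of_set A. avoids T (take (card A - m) xs)}"

lemma avoids_appendD: "avoids T (xs @ ys) \<Longrightarrow> avoids T xs"
  unfolding avoids_def by (metis append.assoc)

lemma avoids_Nil: "avoids T []"
  by (simp add: avoids_def)

lemma length_permutations_of_set: "xs \<in> permutations_of_set A \<Longrightarrow> length xs = card A"
  by (auto simp: permutations_of_set_def distinct_card)

lemma finite_prefix_avoiders [simp]: "finite (prefix_avoiders T m A)"
  by (simp add: prefix_avoiders_def)

text \<open>
  Removing the last entry turns the count for \<open>A\<close> into counts for the sets \<open>A - {a}\<close>. Keeping
  arbitrary value sets here, rather than standardising to an initial segment of the integers, means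
  that \<open>T\<close> need not be invariant under relabelling of the values.
\<close>
lemma card_prefix_avoiders_Suc:
  assumes "finite A" "A \<noteq> {}"
  shows "card (prefix_avoiders T (Suc m) A) = (\<Sum>a\<in>A. card (prefix_avoiders T m (A - {a})))"
proof -
  have eq: "prefix_avoiders T (Suc m) A = (\<Union>a\<in>A. (\<lambda>ys. ys @ [a]) ` prefix_avoiders T m (A - {a}))"
    (is "?L = ?R")
  proof (intro equalityI subsetI)
    fix xs assume xs: "xs \<in> ?L"
    then have len: "length xs = card A" and set: "set xs = A" and dist: "distinct xs"
      using length_permutations_of_set[of xs A] by (auto simp: prefix_avoiders_def permutations_of_set_def)
    have "xs \<noteq> []" using set assms by auto
    then obtain ys a where ya: "xs = ys @ [a]" by (metis rev_exhaust)
    have a: "a \<in> A" using ya set by auto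
    have "set ys = A - {a}" "distinct ys" using ya set dist by auto
    moreover have "take (card A - Suc m) xs = take (card (A - {a}) - m) ys"
      using len ya a assms by (simp add: card_Diff_singleton)
    ultimately have "ys \<in> prefix_avoiders T m (A - {a})"
      using xs by (simp add: prefix_avoiders_def permutations_of_set_def)
    then show "xs \<in> ?R" using a ya by blast
  next
    fix xs assume "xs \<in> ?R"
    then obtain a ys where a: "a \<in> A" and ya: "xs = ys @ [a]"
      and ys: "ys \<in> prefix_avoiders T m (A - {a})" by blast
    have len: "length ys = card (A - {a})"
      using ys length_permutations_of_set by (auto simp: prefix_avoiders_def)
    have "take (card A - Suc m) xs = take (card (A - {a}) - m) ys"
      using len ya a assms by (simp add: card_Diff_singleton)
    then show "xs \<in> ?L"
      using ys a ya by (auto simp: prefix_avoiders_def permutations_of_set_def)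
  qed
  have "card ?R = (\<Sum>a\<in>A. card ((\<lambda>ys. ys @ [a]) ` prefix_avoiders T m (A - {a})))"
    using assms by (intro card_UN_disjoint) auto
  also have "\<dots> = (\<Sum>a\<in>A. card (prefix_avoiders T m (A - {a})))"
    by (intro sum.cong refl card_image) (auto simp: inj_on_def)
  finally show ?thesis using eq by simp
qed

lemma prefix_avoiders_all:
  assumes "finite A" shows "card (prefix_avoiders T (card A) A) = fact (card A)"
  using assms by (simp add: prefix_avoiders_def avoids_Nil)

text \<open>
  The ratio between the levels \<open>1\<close> and \<open>0\<close>, known for sets of size \<open>n\<close>, passes to the levels
  \<open>m + 1\<close> and \<open>m\<close> for sets of size \<open>n + m\<close>: the last \<open>m\<close> entries are unconstrained at both levels
  and can be stripped off one at a time.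
\<close>
lemma ratio_propagates:
  fixes \<beta> :: real
  assumes base: "\<And>B. finite B \<Longrightarrow> card B = n \<Longrightarrow>
      \<beta> * card (prefix_avoiders T 1 B) \<le> card (prefix_avoiders T 0 B)"
    and "finite A" "card A = n + m"
  shows "\<beta> * card (prefix_avoiders T (Suc m) A) \<le> card (prefix_avoiders T m A)"
  using assms(2,3)
proof (induction m arbitrary: A)
  case 0
  then show ?case using base by simp
next
  case (Suc m)
  have ne: "A \<noteq> {}" using Suc.prems by auto
  have "\<beta> * card (prefix_avoiders T (Suc (Suc m)) A)
      = (\<Sum>a\<in>A. \<beta> * card (prefix_avoiders T (Suc m) (A - {a})))"
    using card_prefix_avoiders_Suc[OF Suc.prems(1) ne] by (simp add: sum_distrib_left)
  also have "\<dots> \<le> (\<Sum>a\<in>A. real (card (prefix_avoiders T m (A - {a}))))"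
    using Suc by (intro sum_mono Suc.IH) (auto simp: card_Diff_singleton)
  also have "\<dots> = card (prefix_avoiders T (Suc m) A)"
    using card_prefix_avoiders_Suc[OF Suc.prems(1) ne] by simp
  finally show ?case .
qed

text \<open>
  Both sides are sums over the admissible prefixes \<open>u\<close>. A fixed \<open>u\<close> is continued by an arbitrary
  arrangement of the remaining \<open>m\<close> values, and \<open>rare\<close> bounds the proportion of those in \<open>T\<close>.
\<close>
lemma card_bad_suffix_le:
  fixes p :: "nat \<Rightarrow> real"
  assumes rare: "\<And>V. finite V \<Longrightarrow> V \<noteq> {} \<Longrightarrow>
      card {ys \<in> permutations_of_set V. T ys} \<le> p (card V) * fact (card V)"
    and A: "finite A" and m: "1 \<le> m" "m \<le> card A"
  shows "card {xs \<in> prefix_avoiders T m A. T (drop (card A - m) xs)}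
           \<le> p m * card (prefix_avoiders T m A)"
proof -
  define l where "l = card A - m"
  define X where "X = prefix_avoiders T m A"
  define U where "U = take l ` X"
  have finX: "finite X" and finU: "finite U" by (auto simp: X_def U_def)
  \<comment> \<open>Used twice: with \<open>T\<close> for the bad suffixes and with the trivial predicate for all of them.\<close>
  have split: "card {xs \<in> X. Q (drop l xs)}
      = (\<Sum>u\<in>U. card {ys \<in> permutations_of_set (A - set u). Q ys})" for Q
  proof -
    have eq: "{xs \<in> X. Q (drop l xs)}
        = (\<Union>u\<in>U. (@) u ` {ys \<in> permutations_of_set (A - set u). Q ys})" (is "?L = ?R")
    proof (intro equalityI subsetI)
      fix xs assume xs: "xs \<in> ?L"
      have "set xs = set (take l xs) \<union> set (drop l xs)"
        by (metis append_take_drop_id set_append)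
      moreover have d: "distinct (take l xs @ drop l xs)" and "set xs = A"
        using xs by (auto simp: X_def prefix_avoiders_def permutations_of_set_def)
      ultimately have "drop l xs \<in> permutations_of_set (A - set (take l xs))"
        unfolding distinct_append by (auto simp: permutations_of_set_def)
      then show "xs \<in> ?R" using xs unfolding U_def
        by (auto intro!: bexI[of _ xs] image_eqI[of _ _ "drop l xs"])
    next
      fix xs assume "xs \<in> ?R"
      then obtain x ys where x: "x \<in> X" and ys: "ys \<in> permutations_of_set (A - set (take l x))"
        and xs: "xs = take l x @ ys" and Q: "Q ys" unfolding U_def by blast
      have xp: "set x = A" "distinct x" "length x = card A" "avoids T (take l x)"
        using x length_permutations_of_set[of x A]
        by (auto simp: X_def l_def prefix_avoiders_def permutations_of_set_def)
      then have "set (take l x) \<subseteq> A" using set_take_subset by metis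
      then have "xs \<in> permutations_of_set A" using xs ys xp
        by (auto simp: permutations_of_set_def)
      moreover have "length (take l x) = l" using xp by (simp add: l_def)
      ultimately show "xs \<in> ?L" using xs xp Q
        by (simp add: X_def prefix_avoiders_def flip: l_def)
    qed
    have lenU: "length u = l" if "u \<in> U" for u
      using that length_permutations_of_set
      by (fastforce simp: U_def X_def l_def prefix_avoiders_def)
    have "card ?R = (\<Sum>u\<in>U. card ((@) u ` {ys \<in> permutations_of_set (A - set u). Q ys}))"
      using finU A lenU by (intro card_UN_disjoint) auto
    also have "\<dots> = (\<Sum>u\<in>U. card {ys \<in> permutations_of_set (A - set u). Q ys})"
      by (intro sum.cong refl card_image) (auto simp: inj_on_def)
    finally show ?thesis using eq by simp
  qed
  have cardrest: "card (A - set u) = m" if "u \<in> U" for u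
  proof -
    obtain x where x: "x \<in> X" "u = take l x" using \<open>u \<in> U\<close> by (auto simp: U_def)
    then have xp: "set x = A" "distinct x" "length x = card A"
      using length_permutations_of_set[of x A]
      by (auto simp: X_def prefix_avoiders_def permutations_of_set_def)
    have "set u \<subseteq> A" "card (set u) = l"
      using x xp set_take_subset[of l x] by (auto simp: distinct_card l_def)
    then show ?thesis using A m by (simp add: card_Diff_subset l_def)
  qed
  have "real (card {xs \<in> X. T (drop l xs)})
      = (\<Sum>u\<in>U. real (card {ys \<in> permutations_of_set (A - set u). T ys}))"
    by (simp add: split)
  also have "\<dots> \<le> (\<Sum>u\<in>U. p m * fact m)"
  proof (rule sum_mono)
    fix u assume u: "u \<in> U"
    then have "A - set u \<noteq> {}" using cardrest m by fastforce
    then show "real (card {ys \<in> permutations_of_set (A - set u). T ys}) \<le> p m * fact m"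
      using rare[of "A - set u"] cardrest[OF u] A by simp
  qed
  also have "\<dots> = p m * (\<Sum>u\<in>U. real (card {ys \<in> permutations_of_set (A - set u). True}))"
    using A by (simp add: cardrest)
  also have "(\<Sum>u\<in>U. real (card {ys \<in> permutations_of_set (A - set u). True})) = card X"
    using split[of "\<lambda>_. True"] by simp
  finally show ?thesis by (simp add: X_def l_def)
qed

text \<open>
  The heart of the counting argument. Among the arrangements whose prefix without the last entry
  avoids \<open>T\<close>, those that fail to avoid \<open>T\<close> themselves must end in a block of \<open>T\<close>, since every
  other block lies in that prefix. A union bound over the length of this block, combined with the
  induction hypothesis for smaller sets, limits their number to a proportion \<open>1 - \<beta>\<close>.
\<close>
lemma avoiders_ratio:
  fixes \<beta> :: real and p :: "nat \<Rightarrow> real"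
  assumes rare: "\<And>V. finite V \<Longrightarrow> V \<noteq> {} \<Longrightarrow>
      card {ys \<in> permutations_of_set V. T ys} \<le> p (card V) * fact (card V)"
    and p: "\<And>m. p m \<ge> 0"
    and \<beta>: "\<beta> > 0" and total: "\<And>n. (\<Sum>m=1..n. p m / \<beta> ^ (m - 1)) \<le> 1 - \<beta>"
    and "finite A" "A \<noteq> {}"
  shows "\<beta> * card (prefix_avoiders T 1 A) \<le> card (prefix_avoiders T 0 A)"
  using assms(5,6)
proof (induction "card A" arbitrary: A rule: less_induct)
  case less
  define n where "n = card A"
  define h where "h m = real (card (prefix_avoiders T m A))" for m
  define bad where "bad m = {xs \<in> prefix_avoiders T m A. T (drop (n - m) xs)}" for m
  have cover: "prefix_avoiders T 1 A \<subseteq> prefix_avoiders T 0 A \<union> (\<Union>m\<in>{1..n}. bad m)"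
  proof
    fix xs assume xs: "xs \<in> prefix_avoiders T 1 A"
    then have len: "length xs = n" and perm: "xs \<in> permutations_of_set A"
      and av: "avoids T (take (n - 1) xs)"
      using length_permutations_of_set by (auto simp: prefix_avoiders_def n_def)
    show "xs \<in> prefix_avoiders T 0 A \<union> (\<Union>m\<in>{1..n}. bad m)"
    proof (cases "avoids T xs")
      case True
      then show ?thesis using perm len by (simp add: prefix_avoiders_def n_def)
    next
      case False
      then obtain a b c where abc: "xs = a @ b @ c" "T b" "b \<noteq> []" by (auto simp: avoids_def)
      have "c = []"
      proof (rule ccontr)
        assume "c \<noteq> []"
        then have "take (n - 1) xs = a @ b @ butlast c"
          using abc len by (metis butlast_append butlast_conv_take append_is_Nil_conv)
        then show False using av abc by (auto simp: avoids_def)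
      qed
      then have "length b \<in> {1..n}" "take (n - length b) xs = a" "drop (n - length b) xs = b"
        using abc len by (auto simp: Suc_le_eq)
      moreover have "avoids T a"
      proof -
        have "take (n - 1) xs = a @ butlast b"
          using abc len \<open>c = []\<close> by (metis append_Nil2 butlast_append butlast_conv_take)
        then show ?thesis using av avoids_appendD by metis
      qed
      ultimately show ?thesis using perm abc
        by (auto simp: bad_def prefix_avoiders_def n_def intro!: bexI[of _ "length b"])
    qed
  qed
  \<comment> \<open>Constraining one more entry costs at most a factor \<open>\<beta>\<close>; going from level \<open>k + 1\<close> down to
    level \<open>k\<close> needs the claim for sets of size \<open>n - k\<close>, smaller than \<open>n\<close> because \<open>k \<ge> 1\<close>.\<close>
  have decay: "h m \<le> h 1 / \<beta> ^ (m - 1)" if "1 \<le> m" "m \<le> n" for m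
    using that
  proof (induction m rule: dec_induct)
    case (step k)
    have "\<beta> * h (Suc k) \<le> h k" unfolding h_def
    proof (rule ratio_propagates[where n = "n - k"])
      fix B :: "'a set" assume B: "finite B" "card B = n - k"
      then have "card B < card A" "B \<noteq> {}" using step by (auto simp: n_def)
      then show "\<beta> * card (prefix_avoiders T 1 B) \<le> card (prefix_avoiders T 0 B)"
        using less.hyps B by blast
    qed (use step less.prems in \<open>auto simp: n_def\<close>)
    also have "\<dots> \<le> h 1 / \<beta> ^ (k - 1)" using step by simp
    finally have "h (Suc k) \<le> h 1 / (\<beta> * \<beta> ^ (k - 1))"
      using \<beta> by (simp add: field_simps)
    moreover have "\<beta> * \<beta> ^ (k - 1) = \<beta> ^ k" using step by (simp flip: power_Suc)
    ultimately show ?case by simp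
  qed simp
  have "h 1 \<le> real (card (prefix_avoiders T 0 A \<union> (\<Union>m\<in>{1..n}. bad m)))"
    unfolding h_def using cover by (simp add: card_mono bad_def)
  also have "\<dots> \<le> real (card (prefix_avoiders T 0 A) + (\<Sum>m=1..n. card (bad m)))"
    by (intro of_nat_mono order_trans[OF card_Un_le] add_left_mono card_UN_le) simp
  also have "\<dots> = h 0 + (\<Sum>m=1..n. real (card (bad m)))" by (simp add: h_def)
  also have "\<dots> \<le> h 0 + (\<Sum>m=1..n. p m * (h 1 / \<beta> ^ (m - 1)))"
  proof (intro add_left_mono sum_mono)
    fix m assume m: "m \<in> {1..n}"
    have "real (card (bad m)) \<le> p m * h m"
      unfolding bad_def h_def n_def
      using m less.prems by (intro card_bad_suffix_le rare) (auto simp: n_def)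
    also have "\<dots> \<le> p m * (h 1 / \<beta> ^ (m - 1))"
      using m p by (intro mult_left_mono decay) auto
    finally show "real (card (bad m)) \<le> p m * (h 1 / \<beta> ^ (m - 1))" .
  qed
  also have "\<dots> = h 0 + h 1 * (\<Sum>m=1..n. p m / \<beta> ^ (m - 1))"
    by (simp add: sum_distrib_left mult.commute)
  also have "\<dots> \<le> h 0 + h 1 * (1 - \<beta>)"
    using total by (intro add_left_mono mult_left_mono) (auto simp: h_def)
  finally show ?case by (simp add: h_def algebra_simps)
qed

lemma ex_avoiding_arrangement:
  fixes \<beta> :: real and p :: "nat \<Rightarrow> real"
  assumes rare: "\<And>V. finite V \<Longrightarrow> V \<noteq> {} \<Longrightarrow>
      card {ys \<in> permutations_of_set V. T ys} \<le> p (card V) * fact (card V)"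
    and p: "\<And>m. p m \<ge> 0"
    and \<beta>: "\<beta> > 0" and total: "\<And>n. (\<Sum>m=1..n. p m / \<beta> ^ (m - 1)) \<le> 1 - \<beta>"
    and A: "finite A"
  shows "\<exists>xs \<in> permutations_of_set A. avoids T xs"
proof -
  have pos: "card (prefix_avoiders T 0 A) > 0" using A
  proof (induction "card A" arbitrary: A)
    case 0
    then show ?case using prefix_avoiders_all[of A T] by simp
  next
    case (Suc n)
    then have ne: "A \<noteq> {}" by auto
    then obtain a where a: "a \<in> A" by blast
    have "0 < card (prefix_avoiders T 0 (A - {a}))"
      using Suc a by (intro Suc.hyps) (auto simp: card_Diff_singleton)
    also have "\<dots> \<le> card (prefix_avoiders T 1 A)"
      using card_prefix_avoiders_Suc[OF Suc.prems ne, of T 0] Suc.prems a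
      by (simp add: member_le_sum[of a A "\<lambda>a. card (prefix_avoiders T 0 (A - {a}))"])
    finally have "0 < \<beta> * card (prefix_avoiders T 1 A)" using \<beta> by simp
    then show ?case
      using avoiders_ratio[OF rare p \<beta> total Suc.prems ne] by linarith
  qed
  then have "prefix_avoiders T 0 A \<noteq> {}" by (metis card.empty less_irrefl)
  then obtain xs where "xs \<in> prefix_avoiders T 0 A" by blast
  then have "xs \<in> permutations_of_set A" "avoids T (take (card A) xs)"
    by (auto simp: prefix_avoiders_def)
  then show ?thesis using length_permutations_of_set[of xs A] by auto
qed

section \<open>Words that are split into twins\<close>

text \<open>
  A canonical form of a word up to similarity, with boundedly many values: it records for each
  position how many entries are smaller.
\<close>
definition ranks :: "int list \<Rightarrow> nat list" where
  "ranks xs = map (\<lambda>i. card {j. j < length xs \<and> xs ! j < xs ! i}) [0..<length xs]"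

lemma similar_imp_ranks_eq:
  assumes sim: "similar xs ys" and "distinct xs" "distinct ys"
  shows "ranks xs = ranks ys"
proof -
  have len: "length xs = length ys" using sim by (simp add: similar_def)
  have "xs ! j < xs ! i \<longleftrightarrow> ys ! j < ys ! i" if ij: "i < length xs" "j < length xs" for i j
  proof (cases i j rule: linorder_cases)
    case less
    then have "xs ! i < xs ! j \<longleftrightarrow> ys ! i < ys ! j" using sim ij by (simp add: similar_def)
    moreover have "xs ! i \<noteq> xs ! j" "ys ! i \<noteq> ys ! j"
      using less ij len assms by (auto simp: nth_eq_iff_index_eq)
    ultimately show ?thesis by linarith
  qed (use sim ij in \<open>auto simp: similar_def\<close>)
  then have "{j. j < length xs \<and> xs ! j < xs ! i} = {j. j < length xs \<and> ys ! j < ys ! i}"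
    if "i < length xs" for i
    using that by blast
  then show ?thesis unfolding ranks_def len[symmetric] by simp
qed

text \<open>
  For distinct entries the rank depends on the value and on the set of all values only; this is what
  makes a word recoverable from its ranks and its set of entries.
\<close>
lemma nth_ranks:
  assumes "distinct xs" "i < length xs"
  shows "ranks xs ! i = card {y \<in> set xs. y < xs ! i}"
proof -
  have "{y \<in> set xs. y < xs ! i} = (!) xs ` {j. j < length xs \<and> xs ! j < xs ! i}"
    by (auto simp: in_set_conv_nth)
  moreover have "inj_on ((!) xs) {j. j < length xs \<and> xs ! j < xs ! i}"
    using assms by (auto simp: inj_on_def nth_eq_iff_index_eq)
  ultimately show ?thesis using assms by (simp add: ranks_def card_image)
qed

lemma ranks_set_determine:
  assumes "ranks xs = ranks ys" "set xs = set ys" "distinct xs" "distinct ys"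
  shows "xs = ys"
proof (rule nth_equalityI)
  show len: "length xs = length ys" using assms by (metis distinct_card)
  have mono: "card {z \<in> V. z < x} < card {z \<in> V. z < y}" if "finite V" "x \<in> V" "x < y"
    for V and x y :: int
    using that by (intro psubset_card_mono) auto
  fix i assume i: "i < length xs"
  have "card {z \<in> set xs. z < xs ! i} = ranks ys ! i"
    using nth_ranks[OF assms(3) i] by (simp only: assms(1))
  also have "\<dots> = card {z \<in> set xs. z < ys ! i}"
    using nth_ranks[OF assms(4), of i] i by (simp only: assms(2) len)
  finally have "\<not> xs ! i < ys ! i" "\<not> ys ! i < xs ! i"
    using mono[of "set xs" "xs ! i" "ys ! i"] mono[of "set xs" "ys ! i" "xs ! i"]
      i nth_mem[of i xs] nth_mem[of i ys] unfolding len assms(2) by auto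
  then show "xs ! i = ys ! i" by simp
qed

lemma ranks_in_lists:
  "set (ranks xs) \<subseteq> {..<length xs}" "length (ranks xs) = length xs"
proof -
  have "card {j. j < length xs \<and> xs ! j < xs ! i} < card {..<length xs}" if "i < length xs" for i
    using that by (intro psubset_card_mono) auto
  then show "set (ranks xs) \<subseteq> {..<length xs}" by (auto simp: ranks_def)
qed (simp add: ranks_def)

lemma nths_eq_imp_nth_eq:
  assumes "length xs = length ys" "nths xs P = nths ys P" "i \<in> P" "i < length xs"
  shows "xs ! i = ys ! i"
  using assms
proof (induction xs ys arbitrary: P i rule: list_induct2)
  case (Cons x xs y ys)
  show ?case
  proof (cases i)
    case 0
    then show ?thesis using Cons.prems by (simp add: nths_Cons)
  next
    case (Suc j)
    then show ?thesis using Cons.prems Cons.IH[of "{j. Suc j \<in> P}" j]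
      by (simp add: nths_Cons split: if_splits)
  qed
qed simp

text \<open>
  A whole word split into twins, with the classes given by a colouring \<open>f\<close> of its positions. The
  colouring is taken extensional so that it ranges over a finite set.
\<close>
definition twin_word :: "nat \<Rightarrow> nat \<Rightarrow> int list \<Rightarrow> bool" where
  "twin_word r k ys \<longleftrightarrow> length ys = r * k \<and>
     (\<exists>f \<in> {..<r * k} \<rightarrow>\<^sub>E {..<r}.
        (\<forall>c<r. length (nths ys {i. i < r * k \<and> f i = c}) = k) \<and>
        (\<forall>c<r. \<forall>d<r. similar (nths ys {i. i < r * k \<and> f i = c}) (nths ys {i. i < r * k \<and> f i = d})))"

text \<open>
  The segment occupied by the twins is cut out as a word \<open>b\<close> of its own. Numbering the position
  sets gives the colouring; the position sets lie inside the segment, so the entries they pick from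
  \<open>xs\<close> are picked from \<open>b\<close>.
\<close>
lemma tight_twins_imp_twin_word:
  assumes "tight_twins r k xs F"
  shows "\<exists>a b c. xs = a @ b @ c \<and> twin_word r k b"
proof -
  have F: "finite F" "card F = r" "disjoint F"
    and P: "\<And>P. P \<in> F \<Longrightarrow> P \<subseteq> {..<length xs} \<and> card P = k"
    and sim: "\<And>P Q. P \<in> F \<Longrightarrow> Q \<in> F \<Longrightarrow> similar (nths xs P) (nths xs Q)"
    using assms by (auto simp: tight_twins_def)
  obtain s where s: "s + r * k \<le> length xs" "\<Union>F = {s..<s + r * k}"
    using assms by (auto simp: tight_twins_def)
  obtain e where e: "bij_betw e {0..<r} F"
    using ex_bij_betw_nat_finite[OF F(1)] F(2) by auto
  have eF: "e c \<in> F" if "c < r" for c using e that by (auto simp: bij_betw_def)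
  have e_inj: "c = d" if "c < r" "d < r" "i \<in> e c" "i \<in> e d" for i c d
  proof -
    have "e c = e d" using F(3) eF that by (metis disjointD disjoint_iff)
    then show ?thesis using e that by (auto simp: bij_betw_def inj_on_def)
  qed
  have ex: "\<exists>c<r. i + s \<in> e c" if "i < r * k" for i
  proof -
    have "i + s \<in> \<Union>F" using s that by simp
    then show ?thesis using e by (fastforce simp: bij_betw_def)
  qed
  define f where "f = restrict (\<lambda>i. SOME c. c < r \<and> i + s \<in> e c) {..<r * k}"
  have f: "f i < r \<and> i + s \<in> e (f i)" if "i < r * k" for i
    using someI_ex[OF ex[OF that]] that by (simp add: f_def)
  define a where "a = take s xs"
  define b where "b = take (r * k) (drop s xs)"
  define c where "c = drop (r * k) (drop s xs)"
  have xs: "xs = a @ b @ c" by (simp add: a_def b_def c_def del: drop_drop)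
  have la: "length a = s" and lb: "length b = r * k" using s by (auto simp: a_def b_def)
  have nths_b: "nths b {i. i < r * k \<and> f i = d} = nths xs (e d)" if d: "d < r" for d
  proof -
    have sub: "e d \<subseteq> {s..<s + r * k}" using eF[OF d] s by blast
    have "{i. i < r * k \<and> f i = d} = {i. i + s \<in> e d}"
    proof (intro Collect_cong iffI)
      fix i assume i: "i + s \<in> e d"
      then have "i < r * k" using sub by (auto simp: subset_iff)
      then show "i < r * k \<and> f i = d" using f e_inj[OF _ d _ i] by blast
    qed (use f in blast)
    moreover have "set (nths a (e d)) = {}" "set (nths c {i. i + r * k + s \<in> e d}) = {}"
      using sub la by (auto simp: set_nths subset_iff)
    ultimately show ?thesis
      by (simp add: xs nths_append la lb)
  qed
  have "f \<in> {..<r * k} \<rightarrow>\<^sub>E {..<r}" using f by (auto simp: f_def)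
  moreover have "length (nths xs (e d)) = k" if "d < r" for d
  proof -
    have "{i. i < length xs \<and> i \<in> e d} = e d" using P[OF eF[OF that]] by auto
    then show ?thesis using P[OF eF[OF that]] by (simp add: length_nths)
  qed
  ultimately have "twin_word r k b"
    unfolding twin_word_def using lb nths_b sim eF by (auto intro!: bexI[of _ f])
  then show ?thesis using xs by blast
qed

text \<open>
  A twin word is determined by the colouring \<open>f\<close> of its positions, the colouring \<open>g\<close> of its
  values and the common rank list \<open>t\<close> of its classes: \<open>g\<close> gives the set of entries of each class,
  \<open>t\<close> their order within the class, and \<open>f\<close> their places in the word. The three factors of the
  bound count the possible \<open>f\<close>, \<open>g\<close> and \<open>t\<close>.
\<close>
lemma card_twin_words_le:
  assumes V: "finite V" "card V = r * k" and "r > 0"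
  shows "card {ys \<in> permutations_of_set V. twin_word r k ys} \<le> r ^ (r * k) * r ^ (r * k) * k ^ k"
proof -
  define L where "L = {t :: nat list. set t \<subseteq> {..<k} \<and> length t = k}"
  define I where "I = ({..<r * k} \<rightarrow>\<^sub>E {..<r}) \<times> (V \<rightarrow>\<^sub>E {..<r}) \<times> L"
  define X where "X = (\<lambda>(f :: nat \<Rightarrow> nat, g :: int \<Rightarrow> nat, t). {ys \<in> permutations_of_set V.
      (\<forall>i<r * k. g (ys ! i) = f i) \<and>
      (\<forall>c<r. ranks (nths ys {i. i < r * k \<and> f i = c}) = t)})"
  have finI: "finite I" using V by (auto simp: I_def L_def finite_PiE finite_lists_length_eq)
  have cardI: "card I = r ^ (r * k) * r ^ (r * k) * k ^ k"
    using V by (simp add: I_def L_def card_cartesian_product card_PiE card_lists_length_eq)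
  \<comment> \<open>A triple determines at most one word, so no choice of a colouring for each word is needed.\<close>
  have unique: "ys = zs" if I: "(f, g, t) \<in> I" and ys: "ys \<in> X (f, g, t)" and zs: "zs \<in> X (f, g, t)"
    for f g t ys zs
  proof (rule nth_equalityI)
    have len: "length ys = r * k" "length zs = r * k"
      using ys zs V length_permutations_of_set[of _ V] by (auto simp: X_def)
    then show "length ys = length zs" by simp
    have set_class: "set (nths us {i. i < r * k \<and> f i = c}) = {v \<in> V. g v = c}"
      if us: "us \<in> X (f, g, t)" and lus: "length us = r * k" for us c
    proof -
      have "set us = V" "\<And>i. i < r * k \<Longrightarrow> g (us ! i) = f i"
        using us by (auto simp: X_def permutations_of_set_def)
      then show ?thesis using lus by (force simp: set_nths in_set_conv_nth)
    qed
    fix i assume i: "i < length ys"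
    then have fi: "f i < r" using I len by (auto simp: I_def)
    let ?P = "{j. j < r * k \<and> f j = f i}"
    have "nths ys ?P = nths zs ?P"
    proof (rule ranks_set_determine)
      show "ranks (nths ys ?P) = ranks (nths zs ?P)" using ys zs fi by (simp add: X_def)
      show "set (nths ys ?P) = set (nths zs ?P)"
        using set_class[OF ys len(1)] set_class[OF zs len(2)] by simp
    qed (use ys zs in \<open>auto simp: X_def permutations_of_set_def intro: distinct_nthsI\<close>)
    then show "ys ! i = zs ! i" using i len by (intro nths_eq_imp_nth_eq[of ys zs ?P]) auto
  qed
  have "{ys \<in> permutations_of_set V. twin_word r k ys} \<subseteq> (\<Union>x\<in>I. X x)"
  proof clarify
    fix ys assume perm: "ys \<in> permutations_of_set V" and "twin_word r k ys"
    then obtain f where len: "length ys = r * k" and f: "f \<in> {..<r * k} \<rightarrow>\<^sub>E {..<r}"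
      and lk: "\<And>c. c < r \<Longrightarrow> length (nths ys {i. i < r * k \<and> f i = c}) = k"
      and sim: "\<And>c d. c < r \<Longrightarrow> d < r \<Longrightarrow>
        similar (nths ys {i. i < r * k \<and> f i = c}) (nths ys {i. i < r * k \<and> f i = d})"
      by (auto simp: twin_word_def)
    have ys: "distinct ys" "set ys = V" using perm by (auto simp: permutations_of_set_def)
    then have bij: "bij_betw ((!) ys) {..<r * k} V" using len by (simp add: bij_betw_nth)
    define g where "g = restrict (\<lambda>v. f (inv_into {..<r * k} ((!) ys) v)) V"
    define t where "t = ranks (nths ys {i. i < r * k \<and> f i = 0})"
    have "g \<in> V \<rightarrow>\<^sub>E {..<r}"
      using f bij_betw_inv_into[OF bij] by (fastforce simp: g_def bij_betw_def)
    moreover have "t \<in> L"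
      using ranks_in_lists[of "nths ys {i. i < r * k \<and> f i = 0}"] lk[of 0] assms
      by (simp add: t_def L_def)
    moreover have "g (ys ! i) = f i" if "i < r * k" for i
      using that bij ys len nth_mem[of i ys] by (simp add: g_def bij_betw_inv_into_left)
    moreover have "ranks (nths ys {i. i < r * k \<and> f i = c}) = t" if "c < r" for c
      unfolding t_def using that assms sim ys
      by (intro similar_imp_ranks_eq) (auto intro: distinct_nthsI)
    ultimately have "ys \<in> X (f, g, t)" "(f, g, t) \<in> I"
      using f perm by (auto simp: X_def I_def)
    then show "ys \<in> (\<Union>x\<in>I. X x)" by blast
  qed
  then have "card {ys \<in> permutations_of_set V. twin_word r k ys} \<le> card (\<Union>x\<in>I. X x)"
    using finI by (intro card_mono) (auto simp: X_def)
  also have "\<dots> \<le> (\<Sum>x\<in>I. card (X x))" using finI by (rule card_UN_le)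
  also have "\<dots> \<le> (\<Sum>x\<in>I. 1)"
  proof (rule sum_mono)
    fix x assume x: "x \<in> I"
    obtain f g t where fgt: "x = (f, g, t)" by (cases x) auto
    then have "\<exists>z. X x \<subseteq> {z}" using unique[of f g t] x by blast
    then show "card (X x) \<le> 1"
      by (metis card_mono card.empty card_insert_disjoint empty_iff finite.intros One_nat_def)
  qed
  finally show ?thesis using cardI by simp
qed

section \<open>Numerical estimates\<close>

text \<open>
  The term of index \<open>n\<close> in the exponential series at \<open>n\<close> is at most \<open>exp n\<close>, and \<open>exp 1 \<le> 3\<close>.
\<close>
lemma power_self_le_fact: "real n ^ n \<le> 3 ^ n * fact n"
proof -
  have "real n ^ n / fact n \<le> exp (real n)"
    using sum_le_suminf[OF sums_summable[OF exp_converges[of "real n"]], of "{n}"]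
    by (simp add: sums_unique[OF exp_converges[of "real n"]] divide_inverse mult.commute)
  also have "\<dots> = exp 1 ^ n" by (simp flip: exp_of_nat_mult)
  also have "\<dots> \<le> 3 ^ n" by (intro power_mono exp_le) simp
  finally show ?thesis by (simp add: field_simps)
qed

lemma fifteen_mult_le_power_five: assumes "r \<ge> 3" shows "15 * real r \<le> 2 * 5 ^ (r - 1)"
  using assms by (induction r rule: dec_induct) (auto simp: power_eq_if)

text \<open>
  After multiplying by \<open>(r * k) ^ (r * k) \<le> 3 ^ (r * k) * (r * k)!\<close>, everything is a \<open>k\<close>-th power
  except for common factors, and the claim reduces to
  \<open>3 * r * (3 * r / k) ^ (r - 1) \<le> 2 / 5\<close>. As \<open>3 * r / k < 1 / 5\<close>, the assumption
  \<open>r \<ge> 3\<close> suffices: for \<open>r = 3\<close> the left-hand side is bounded by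
  \<open>9 / 25\<close>, while for \<open>r = 2\<close> this bound would exceed \<open>1\<close>.
\<close>
lemma twin_word_ratio:
  assumes r: "r \<ge> 3" and k: "k > 15 * r"
  shows "real (r ^ (r * k) * r ^ (r * k) * k ^ k) \<le> (2 / 5) ^ k * fact (r * k)"
proof -
  have pos: "real k > 0" "real r > 0" using r k by auto
  have small: "real r ^ r * real k * 3 ^ r \<le> (2 / 5) * real k ^ r"
  proof -
    obtain q where q: "r = Suc q" using r by (cases r) auto
    have "real r ^ r * real k * 3 ^ r = 3 * real r * real k * (3 * real r) ^ q"
    proof -
      have "real r ^ r = real r * real r ^ q" "(3 :: real) ^ r = 3 * 3 ^ q"
        by (simp_all add: q)
      then show ?thesis by (simp only: power_mult_distrib mult_ac)
    qed
    also have "\<dots> \<le> 3 * real r * real k * (real k / 5) ^ q"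
      using k by (intro mult_left_mono power_mono) auto
    also have "\<dots> = (3 * real r / 5 ^ q) * (real k * real k ^ q)"
      by (simp add: power_divide)
    also have "\<dots> \<le> (2 / 5) * (real k * real k ^ q)"
      using fifteen_mult_le_power_five[OF r] q by (intro mult_right_mono) (auto simp: field_simps)
    finally show ?thesis by (simp add: q)
  qed
  have "real (r * k) ^ (r * k) * real (r ^ (r * k) * r ^ (r * k) * k ^ k)
      \<le> 3 ^ (r * k) * fact (r * k) * real (r ^ (r * k) * r ^ (r * k) * k ^ k)"
    by (intro mult_right_mono power_self_le_fact) simp
  also have "\<dots> = real r ^ (r * k) * fact (r * k) * (real r ^ r * real k * 3 ^ r) ^ k"
    by (simp add: power_mult_distrib power_mult)
  also have "\<dots> \<le> real r ^ (r * k) * fact (r * k) * ((2 / 5) * real k ^ r) ^ k"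
    using small by (intro mult_left_mono power_mono) auto
  also have "((2 / 5) * real k ^ r) ^ k = (2 / 5) ^ k * real k ^ (r * k)"
    by (simp only: power_mult_distrib power_mult)
  also have "real r ^ (r * k) * fact (r * k) * ((2 / 5) ^ k * real k ^ (r * k))
      = real (r * k) ^ (r * k) * ((2 / 5) ^ k * fact (r * k))"
    by (simp only: of_nat_mult power_mult_distrib mult_ac)
  finally show ?thesis using pos by (subst (asm) mult_le_cancel_left_pos) auto
qed

lemma geometric_tail_le:
  assumes r: "r \<ge> 1"
  shows "(\<Sum>k=15 * r + 1..n. (4 / 5 :: real) ^ k) \<le> 1 / (2 * real r)"
proof -
  have "(\<Sum>k=15 * r + 1..n. (4 / 5 :: real) ^ k) \<le> 5 * (4 / 5) ^ (15 * r + 1)"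
    by (cases "15 * r + 1 \<le> n") (simp_all add: sum_gp)
  also have "\<dots> = 4 * ((4 / 5) ^ 15) ^ r" by (simp add: power_mult)
  also have "\<dots> \<le> 4 * (1 / 8) ^ r"
    by (intro mult_left_mono power_mono) (auto simp: power_divide)
  also have "\<dots> = 4 / 8 ^ r" by (simp add: power_divide)
  also have "\<dots> \<le> 4 / (8 * real r)"
  proof (rule divide_left_mono)
    show "8 * real r \<le> 8 ^ r" using r by (induction r rule: dec_induct) auto
  qed (use r in auto)
  also have "\<dots> = 1 / (2 * real r)" by simp
  finally show ?thesis .
qed

theorem theorem4p2:
  fixes n r :: nat
  assumes "n \<ge> 1" and "r \<ge> 3"
  shows "tt r n \<le> 15 * r"
proof -
  define T where "T ys \<longleftrightarrow> (\<exists>k>15 * r. twin_word r k ys)" for ys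
  define p :: "nat \<Rightarrow> real" where
    "p m = (if r dvd m \<and> m div r > 15 * r then (2 / 5) ^ (m div r) else 0)" for m
  define \<beta> :: real where "\<beta> = 1 - 1 / (2 * real r)"
  have \<beta>: "\<beta> > 0" "\<beta> \<le> 1" using assms by (auto simp: \<beta>_def field_simps)
  \<comment> \<open>Bernoulli: \<open>(1 - 1 / (2 * r)) ^ r \<ge> 1 - 1 / 2\<close>.\<close>
  have "1 / 2 \<le> \<beta> ^ r"
    using Bernoulli_inequality[of "- 1 / (2 * real r)" r] assms by (simp add: \<beta>_def field_simps)
  have "\<exists>xs \<in> permutations_of_set {1..int n}. avoids T xs"
  proof (rule ex_avoiding_arrangement[where p = p and \<beta> = \<beta>])
    fix V :: "int set" assume V: "finite V" "V \<noteq> {}"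
    show "card {ys \<in> permutations_of_set V. T ys} \<le> p (card V) * fact (card V)"
    proof (cases "{ys \<in> permutations_of_set V. T ys} = {}")
      case True
      then show ?thesis by (simp only: card.empty) (simp add: p_def)
    next
      case False
      then obtain k ys where k: "k > 15 * r" and "ys \<in> permutations_of_set V" "twin_word r k ys"
        by (auto simp: T_def)
      then have V_card: "card V = r * k"
        using length_permutations_of_set[of ys V] by (auto simp: twin_word_def)
      \<comment> \<open>All twin words on \<open>V\<close> have the same twin length, because \<open>r * k = card V\<close>.\<close>
      have "T ys \<Longrightarrow> ys \<in> permutations_of_set V \<Longrightarrow> twin_word r k ys" for ys
        using length_permutations_of_set[of ys V] V_card assms by (auto simp: T_def twin_word_def)
      then have "{ys \<in> permutations_of_set V. T ys} \<subseteq> {ys \<in> permutations_of_set V. twin_word r k ys}"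
        by blast
      then have "card {ys \<in> permutations_of_set V. T ys}
          \<le> card {ys \<in> permutations_of_set V. twin_word r k ys}" by (intro card_mono) auto
      also have "\<dots> \<le> r ^ (r * k) * r ^ (r * k) * k ^ k"
        using V V_card assms by (intro card_twin_words_le) auto
      finally have "real (card {ys \<in> permutations_of_set V. T ys})
          \<le> real (r ^ (r * k) * r ^ (r * k) * k ^ k)" by (rule of_nat_mono)
      also have "\<dots> \<le> (2 / 5) ^ k * fact (r * k)" by (rule twin_word_ratio) fact+
      finally show ?thesis using V_card k assms by (simp add: p_def)
    qed
  next
    fix N
    \<comment> \<open>Only the multiples \<open>m = r * k\<close> with \<open>k > 15 * r\<close> contribute.\<close>
    have "(\<Sum>m=1..N. p m / \<beta> ^ (m - 1)) = (\<Sum>m\<in>(*) r ` {15 * r + 1..N div r}. p m / \<beta> ^ (m - 1))"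
    proof (rule sum.mono_neutral_right)
      show "(*) r ` {15 * r + 1..N div r} \<subseteq> {1..N}"
        using assms by (auto simp: less_eq_div_iff_mult_less_eq mult.commute)
      show "\<forall>m\<in>{1..N} - (*) r ` {15 * r + 1..N div r}. p m / \<beta> ^ (m - 1) = 0"
      proof
        fix m assume m: "m \<in> {1..N} - (*) r ` {15 * r + 1..N div r}"
        have "\<not> (r dvd m \<and> m div r > 15 * r)"
        proof
          assume d: "r dvd m \<and> m div r > 15 * r"
          then have "m div r \<in> {15 * r + 1..N div r}" using m by (simp add: div_le_mono)
          moreover have "m = r * (m div r)" using d by simp
          ultimately show False using m by blast
        qed
        then show "p m / \<beta> ^ (m - 1) = 0" by (auto simp: p_def)
      qed
    qed simp
    also have "\<dots> = (\<Sum>k=15 * r + 1..N div r. p (r * k) / \<beta> ^ (r * k - 1))"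
      using assms by (subst sum.reindex) (auto simp: inj_on_def)
    also have "\<dots> \<le> (\<Sum>k=15 * r + 1..N div r. (4 / 5) ^ k)"
    proof (rule sum_mono)
      fix k assume k: "k \<in> {15 * r + 1..N div r}"
      have "(1 / 2) ^ k \<le> (\<beta> ^ r) ^ k" using \<open>1 / 2 \<le> \<beta> ^ r\<close> by (intro power_mono) auto
      also have "\<dots> \<le> \<beta> ^ (r * k - 1)"
        using \<beta> by (simp flip: power_mult) (intro power_decreasing, auto)
      finally have "p (r * k) / \<beta> ^ (r * k - 1) \<le> (2 / 5) ^ k / (1 / 2) ^ k"
        using k assms \<beta> by (intro frac_le) (auto simp: p_def)
      also have "\<dots> = (4 / 5) ^ k" by (simp flip: power_divide)
      finally show "p (r * k) / \<beta> ^ (r * k - 1) \<le> (4 / 5) ^ k" .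
    qed
    also have "\<dots> \<le> 1 - \<beta>" using geometric_tail_le[of r] assms by (simp add: \<beta>_def)
    finally show "(\<Sum>m=1..N. p m / \<beta> ^ (m - 1)) \<le> 1 - \<beta>" .
  qed (use \<beta> in \<open>auto simp: p_def\<close>)
  then obtain xs where perm: "xs \<in> permutations_of_set {1..int n}" and av: "avoids T xs" by blast
  have "k \<le> 15 * r" if tw: "tight_twins r k xs F" for k F
  proof (rule ccontr)
    assume k: "\<not> k \<le> 15 * r"
    obtain a b c where "xs = a @ b @ c" and b: "twin_word r k b"
      using tight_twins_imp_twin_word[OF tw] by blast
    moreover have "T b" using b k unfolding T_def not_le by blast
    ultimately have "b = []" using av by (auto simp: avoids_def)
    then show False using b k assms by (simp add: twin_word_def)
  qed
  then have "tt_perm r xs \<le> 15 * r"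
    unfolding tt_perm_def using finite_twin_lengths[of r xs] assms by (subst Max_le_iff) auto
  moreover have "tt r n \<le> tt_perm r xs"
    unfolding tt_def
  proof (rule Min_le)
    show "finite {tt_perm r xs |xs. permutation_of n xs}"
      using finite_permutation_of by simp
    show "tt_perm r xs \<in> {tt_perm r xs |xs. permutation_of n xs}"
      using perm by (auto simp: permutation_of_def permutations_of_set_def)
  qed
  ultimately show ?thesis by simp
qed

end
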